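(* Let $(H^+,\oplus)$ be a gyrogroup, let $H^-$ be a set disjoint from $H^+$, let $\varphi:H^+\to H^-$ be a bijection, and let $(G,\otimes)$, $G=H^+\cup H^-$, be the gyrogroup defined in the context. If $B$ is a subgyrogroup of $G$ such that $B\nsubseteq H^+$, then the following hold: (1) there exist a subgyrogroup $A^+\leq H^+$ and a subset $L^-\subseteq H^-$ such that $B=A^+\cup L^-$; and, for these $A^+$ and $L^-$, setting $L^+=\varphi^{-1}(L^-)$, (2) $A^+\cap L^+=\emptyset$ or $L^+=A^+$; (3) $A^+\cup L^+\leq H^+$ (that is, $A^+\cup L^+$ is a subgyrogroup of $H^+$); (4) $|A^+|=|L^-|$.
   Context: A groupoid $(G,\oplus)$ is a gyrogroup if: (i) there is $0\in G$ with $0\oplus x=x$ for all $x\in G$; (ii) for each $a\in G$ there is $b\in G$ with $b\oplus a=0$; (iii) there is a function $\mathrm{gyr}:G\times G\to \mathrm{Aut}(G,\oplus)$, written $\mathrm{gyr}[a,b]c=\mathrm{gyr}(a,b)(c)$, such that $a\oplus(b\oplus c)=(a\oplus b)\oplus \mathrm{gyr}[a,b]c$ for all $a,b,c\in G$; (iv) $\mathrm{gyr}[a,b]=\mathrm{gyr}[a\oplus b,b]$ for all $a,b\in G$. A nonempty subset $H$ of a gyrogroup $T$ is a subgyrogroup of $T$, written $H\leq T$, if $H$ is a gyrogroup under the operation inherited from $T$ and for all $a,b\in H$ the restriction of $\mathrm{gyr}[a,b]$ to $H$ is an automorphism of $H$. Construction. An arbitrary element of $H^+$ is denoted $x^+$,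 and $x^-=\varphi(x^+)$; for $h\in H^+$, $(h)^-$ means $\varphi(h)$. Every element of $G=H^+\cup H^-$ is uniquely of the form $x^{\epsilon}$ with $x^+\in H^+$, $\epsilon\in\{+,-\}$. The operation on $G$ is $a^{\epsilon}\otimes b^{\delta}=a^+\oplus b^+$ if $\epsilon=\delta$, and $a^{\epsilon}\otimes b^{\delta}=(a^+\oplus b^+)^-$ if $\epsilon\neq\delta$. Then $(G,\otimes)$ is a gyrogroup with gyrator $\mathrm{gyr}_G[a^{\epsilon},b^{\delta}](t^{+})=\mathrm{gyr}_{H^+}[a^+,b^+](t^+)$ and $\mathrm{gyr}_G[a^{\epsilon},b^{\delta}](t^{-})=(\mathrm{gyr}_{H^+}[a^+,b^+](t^+))^-$. *)

theory Defs
  imports "HOL-Library.Equipollence"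
begin

definition gyro_aut :: "'a set \<Rightarrow> ('a \<Rightarrow> 'a \<Rightarrow> 'a) \<Rightarrow> ('a \<Rightarrow> 'a) \<Rightarrow> bool" where
  "gyro_aut G add f \<longleftrightarrow>
     bij_betw f G G \<and> (\<forall>x\<in>G. \<forall>y\<in>G. f (add x y) = add (f x) (f y))"

(* The gyrator is a parameter, because subgyrogroups refer to the gyrator of the ambient
   gyrogroup.  Only the behaviour of add and gyr on the carrier matters. *)
locale gyrogroup =
  fixes G :: "'a set"
    and add :: "'a \<Rightarrow> 'a \<Rightarrow> 'a"
    and gyr :: "'a \<Rightarrow> 'a \<Rightarrow> 'a \<Rightarrow> 'a"
  assumes closed: "\<lbrakk>a \<in> G; b \<in> G\<rbrakk> \<Longrightarrow> add a b \<in> G"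
    and left_identity_inverse:
      "\<exists>z\<in>G. (\<forall>x\<in>G. add z x = x) \<and> (\<forall>a\<in>G. \<exists>b\<in>G. add b a = z)"
    and gyr_aut: "\<lbrakk>a \<in> G; b \<in> G\<rbrakk> \<Longrightarrow> gyro_aut G add (gyr a b)"
    and gyroassociative:
      "\<lbrakk>a \<in> G; b \<in> G; c \<in> G\<rbrakk> \<Longrightarrow> add a (add b c) = add (add a b) (gyr a b c)"
    and left_loop:
      "\<lbrakk>a \<in> G; b \<in> G; c \<in> G\<rbrakk> \<Longrightarrow> gyr a b c = gyr (add a b) b c"

(* H is a gyrogroup in its own right, with some gyrator g; in addition the gyrations
   of the ambient gyrogroup T restrict to automorphisms of H. *)
definition subgyrogroup ::
  "'a set \<Rightarrow> 'a set \<Rightarrow> ('a \<Rightarrow> 'a \<Rightarrow> 'a) \<Rightarrow> ('a \<Rightarrow> 'a \<Rightarrow> 'a \<Rightarrow> 'a) \<Rightarrow> bool" where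
  "subgyrogroup H T add gyr \<longleftrightarrow>
     H \<noteq> {} \<and> H \<subseteq> T \<and> (\<exists>g. gyrogroup H add g) \<and>
     (\<forall>a\<in>H. \<forall>b\<in>H. gyro_aut H add (gyr a b))"

(* For x in Hp \<union> \<phi> ` Hp, the element x\<^sup>+ of Hp such that x is x\<^sup>+ or \<phi> x\<^sup>+. *)
definition pos :: "'a set \<Rightarrow> ('a \<Rightarrow> 'a) \<Rightarrow> 'a \<Rightarrow> 'a" where
  "pos Hp \<phi> x = (if x \<in> Hp then x else inv_into Hp \<phi> x)"

definition double_add ::
  "'a set \<Rightarrow> ('a \<Rightarrow> 'a) \<Rightarrow> ('a \<Rightarrow> 'a \<Rightarrow> 'a) \<Rightarrow> 'a \<Rightarrow> 'a \<Rightarrow> 'a" where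
  "double_add Hp \<phi> add a b =
     (if a \<in> Hp \<longleftrightarrow> b \<in> Hp then add (pos Hp \<phi> a) (pos Hp \<phi> b)
      else \<phi> (add (pos Hp \<phi> a) (pos Hp \<phi> b)))"

definition double_gyr ::
  "'a set \<Rightarrow> ('a \<Rightarrow> 'a) \<Rightarrow> ('a \<Rightarrow> 'a \<Rightarrow> 'a \<Rightarrow> 'a) \<Rightarrow> 'a \<Rightarrow> 'a \<Rightarrow> 'a \<Rightarrow> 'a" where
  "double_gyr Hp \<phi> gyr a b t =
     (if t \<in> Hp then gyr (pos Hp \<phi> a) (pos Hp \<phi> b) t
      else \<phi> (gyr (pos Hp \<phi> a) (pos Hp \<phi> b) (pos Hp \<phi> t)))"

lemma gyrogroup_double:
  assumes gg: "gyrogroup Hp add gyr" and disj: "Hp \<inter> Hm = {}" and bij: "bij_betw \<phi> Hp Hm"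
  shows "gyrogroup (Hp \<union> Hm) (double_add Hp \<phi> add) (double_gyr Hp \<phi> gyr)"
proof -
  interpret gyrogroup Hp add gyr by (rule gg)
  let ?G = "Hp \<union> Hm" and ?p = "pos Hp \<phi>"
  let ?add = "double_add Hp \<phi> add" and ?gyr = "double_gyr Hp \<phi> gyr"
  have inj: "inj_on \<phi> Hp" and im: "\<phi> ` Hp = Hm"
    using bij by (auto simp: bij_betw_def)
  have phi: "\<phi> x \<in> Hm" "\<phi> x \<notin> Hp" if "x \<in> Hp" for x using that im disj by auto
  have p: "?p x \<in> Hp" if "x \<in> ?G" for x
    using that im by (auto simp: pos_def inv_into_into)
  have p_pos: "?p x = x" if "x \<in> Hp" for x using that by (simp add: pos_def)
  have p_phi: "?p (\<phi> x) = x" if "x \<in> Hp" for x using that phi inj by (simp add: pos_def)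
  have eqI: "x = y" if "x \<in> ?G" "y \<in> ?G" "x \<in> Hp \<longleftrightarrow> y \<in> Hp" "?p x = ?p y" for x y
    using that im p_pos p_phi by auto
  have gyr_in: "gyr a b c \<in> Hp" if "a \<in> Hp" "b \<in> Hp" "c \<in> Hp" for a b c
    using gyr_aut that unfolding gyro_aut_def bij_betw_def by blast
  have add_G: "?add a b \<in> ?G" and add_Hp: "?add a b \<in> Hp \<longleftrightarrow> (a \<in> Hp \<longleftrightarrow> b \<in> Hp)"
    and p_add: "?p (?add a b) = add (?p a) (?p b)" if "a \<in> ?G" "b \<in> ?G" for a b
    using closed[OF p[OF that(1)] p[OF that(2)]] phi p_pos p_phi
    by (auto simp: double_add_def)
  have gyr_G: "?gyr a b c \<in> ?G" and gyr_Hp: "?gyr a b c \<in> Hp \<longleftrightarrow> c \<in> Hp"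
    and p_gyr: "?p (?gyr a b c) = gyr (?p a) (?p b) (?p c)"
    if "a \<in> ?G" "b \<in> ?G" "c \<in> ?G" for a b c
    using gyr_in[OF p[OF that(1)] p[OF that(2)] p[OF that(3)]] phi p_pos p_phi
    by (auto simp: double_gyr_def)
  note simps = p p_add p_gyr add_G gyr_G add_Hp gyr_Hp
  show ?thesis
  proof
    show "?add a b \<in> ?G" if "a \<in> ?G" "b \<in> ?G" for a b using that by (rule add_G)
  next
    obtain z where z: "z \<in> Hp" "\<And>x. x \<in> Hp \<Longrightarrow> add z x = x"
      and inv: "\<And>a. a \<in> Hp \<Longrightarrow> \<exists>b\<in>Hp. add b a = z"
      using left_identity_inverse by blast
    have zG: "z \<in> ?G" and pz: "?p z = z" using z(1) p_pos by simp_all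
    have "?add z x = x" if "x \<in> ?G" for x
      by (rule eqI) (use that zG in \<open>simp_all only: simps pz z simp_thms\<close>)
    moreover have "\<exists>b\<in>?G. ?add b a = z" if a: "a \<in> ?G" for a
    proof -
      obtain b where b: "b \<in> Hp" "add b (?p a) = z" using inv p[OF a] by blast
      define b' where "b' = (if a \<in> Hp then b else \<phi> b)"
      have b': "b' \<in> ?G" "b' \<in> Hp \<longleftrightarrow> a \<in> Hp" "?p b' = b"
        using b phi p_pos p_phi by (auto simp: b'_def)
      have "?add b' a = z"
        by (rule eqI) (use a b b' z zG in \<open>simp_all only: simps pz simp_thms\<close>)
      then show ?thesis using b'(1) by blast
    qed
    ultimately show "\<exists>z\<in>?G. (\<forall>x\<in>?G. ?add z x = x) \<and> (\<forall>a\<in>?G. \<exists>b\<in>?G. ?add b a = z)"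
      using zG by blast
  next
    fix a b assume ab: "a \<in> ?G" "b \<in> ?G"
    have aut: "bij_betw (gyr (?p a) (?p b)) Hp Hp"
      "\<And>x y. x \<in> Hp \<Longrightarrow> y \<in> Hp \<Longrightarrow>
         gyr (?p a) (?p b) (add x y) = add (gyr (?p a) (?p b) x) (gyr (?p a) (?p b) y)"
      using gyr_aut[OF p[OF ab(1)] p[OF ab(2)]] by (auto simp: gyro_aut_def)
    have "inj_on (?gyr a b) ?G"
    proof (rule inj_onI)
      fix x y assume xy: "x \<in> ?G" "y \<in> ?G" and eq: "?gyr a b x = ?gyr a b y"
      have "gyr (?p a) (?p b) (?p x) = gyr (?p a) (?p b) (?p y)"
        using p_gyr[OF ab xy(1)] p_gyr[OF ab xy(2)] eq by simp
      then have "?p x = ?p y"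
        using aut(1) p[OF xy(1)] p[OF xy(2)] by (auto simp: bij_betw_def dest: inj_onD)
      moreover have "x \<in> Hp \<longleftrightarrow> y \<in> Hp"
        using gyr_Hp[OF ab xy(1)] gyr_Hp[OF ab xy(2)] eq by simp
      ultimately show "x = y" using xy eqI by blast
    qed
    moreover have "\<exists>x\<in>?G. y = ?gyr a b x" if y: "y \<in> ?G" for y
    proof -
      obtain x where x: "x \<in> Hp" "gyr (?p a) (?p b) x = ?p y"
        using aut(1) p[OF y] unfolding bij_betw_def by (metis imageE)
      define x' where "x' = (if y \<in> Hp then x else \<phi> x)"
      have x': "x' \<in> ?G" "x' \<in> Hp \<longleftrightarrow> y \<in> Hp" "?p x' = x"
        using x phi p_pos p_phi by (auto simp: x'_def)
      have "y = ?gyr a b x'"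
        by (rule eqI) (use ab y x x' in \<open>simp_all only: simps simp_thms\<close>)
      then show ?thesis using x'(1) by blast
    qed
    ultimately have "bij_betw (?gyr a b) ?G ?G"
      using gyr_G[OF ab] unfolding bij_betw_def by blast
    moreover have "?gyr a b (?add x y) = ?add (?gyr a b x) (?gyr a b y)"
      if "x \<in> ?G" "y \<in> ?G" for x y
      by (rule eqI) (use ab that in \<open>simp_all only: simps simp_thms aut(2)\<close>)
    ultimately show "gyro_aut ?G ?add (?gyr a b)" by (simp add: gyro_aut_def)
  next
    fix a b c assume abc: "a \<in> ?G" "b \<in> ?G" "c \<in> ?G"
    show "?add a (?add b c) = ?add (?add a b) (?gyr a b c)"
      by (rule eqI)
        (use abc gyroassociative[of "?p a" "?p b" "?p c"] in
          \<open>simp_all only: simps simp_thms, blast\<close>)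
    show "?gyr a b c = ?gyr (?add a b) b c"
      by (rule eqI) (use abc left_loop[of "?p a" "?p b" "?p c"] in \<open>simp_all only: simps simp_thms\<close>)
  qed
qed

end

(* The sign of a product in the double is the product of the signs, and forgetting the sign is a
   homomorphism onto H+; hence the positive part of B and the image of B under forgetting the
   sign are both subgyrogroups of H+, and the latter is the union of A+ and L+.  A left
   translation by a negative element of B permutes B and reverses signs, which gives the
   equipollence.  If some x+ and x- both lie in B, then so does 0-, and translation by 0-
   exchanges x+ and x- for all x. *)

theory Submission
  imports Defs
begin

section \<open>Left translations, idempotents and a criterion for subgyrogroups\<close>

context gyrogroup
begin

lemma gyr_bij: "a \<in> G \<Longrightarrow> b \<in> G \<Longrightarrow> bij_betw (gyr a b) G G"
  using gyr_aut by (simp add: gyro_aut_def)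

lemma gyr_add:
  "\<lbrakk>a \<in> G; b \<in> G; x \<in> G; y \<in> G\<rbrakk> \<Longrightarrow> gyr a b (add x y) = add (gyr a b x) (gyr a b y)"
  using gyr_aut by (simp add: gyro_aut_def)

lemma gyr_closed: "\<lbrakk>a \<in> G; b \<in> G; c \<in> G\<rbrakk> \<Longrightarrow> gyr a b c \<in> G"
  using gyr_bij bij_betwE by blast

text \<open>Gyroassociativity produces \<open>add (add b a) (gyr b a c)\<close>, and
  \<open>add b a\<close> acts as an identity. This reduces injectivity and surjectivity of left
  translations to those of gyrations.\<close>

lemma add_left_inverse:
  assumes "a \<in> G" "b \<in> G" "c \<in> G" "\<And>x. x \<in> G \<Longrightarrow> add (add b a) x = x"
  shows "add b (add a c) = gyr b a c"
  using assms by (simp add: gyroassociative gyr_closed)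

lemma inj_on_add_left:
  assumes a: "a \<in> G"
  shows "inj_on (add a) G"
proof (rule inj_onI)
  fix x y assume xy: "x \<in> G" "y \<in> G" and eq: "add a x = add a y"
  obtain b where b: "b \<in> G" "\<And>x. x \<in> G \<Longrightarrow> add (add b a) x = x"
    using left_identity_inverse a by metis
  have "gyr b a x = gyr b a y"
    using add_left_inverse[OF a b(1) _ b(2)] xy eq by metis
  then show "x = y"
    using gyr_bij[OF b(1) a] xy by (auto simp: bij_betw_def dest: inj_onD)
qed

lemma add_left_cancel: "\<lbrakk>a \<in> G; x \<in> G; y \<in> G\<rbrakk> \<Longrightarrow> add a x = add a y \<longleftrightarrow> x = y"
  using inj_on_add_left by (auto dest: inj_onD)

lemma bij_betw_add_left:
  assumes a: "a \<in> G"
  shows "bij_betw (add a) G G"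
proof -
  have "\<exists>x\<in>G. add a x = y" if y: "y \<in> G" for y
  proof -
    obtain b where b: "b \<in> G" "\<And>x. x \<in> G \<Longrightarrow> add (add b a) x = x"
      using left_identity_inverse a by metis
    \<comment> \<open>The preimage of \<open>y\<close> under \<open>add a\<close> must satisfy
      \<open>gyr b a x = add b y\<close>; bijectivity of the gyration provides it.\<close>
    have "add b y \<in> gyr b a ` G"
      using gyr_bij[OF b(1) a] closed[OF b(1) y] by (simp add: bij_betw_def)
    then obtain x where x: "x \<in> G" "gyr b a x = add b y"
      by (metis imageE)
    then have "add b (add a x) = add b y"
      using add_left_inverse[OF a b(1) x(1) b(2)] by simp
    then show ?thesis
      using add_left_cancel a b(1) closed x(1) y by blast
  qed
  then show ?thesis
    using inj_on_add_left[OF a] closed[OF a] unfolding bij_betw_def by blast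
qed

text \<open>The last clause, uniqueness of idempotents, serves to match the identity of a
  subgyrogroup with the ambient one.\<close>

lemma identityE:
  obtains z where "z \<in> G" "\<And>x. x \<in> G \<Longrightarrow> add z x = x" "\<And>a. a \<in> G \<Longrightarrow> \<exists>b\<in>G. add b a = z"
    "\<And>e. \<lbrakk>e \<in> G; add e e = e\<rbrakk> \<Longrightarrow> e = z"
proof -
  obtain z where z: "z \<in> G" "\<And>x. x \<in> G \<Longrightarrow> add z x = x"
      "\<And>a. a \<in> G \<Longrightarrow> \<exists>b\<in>G. add b a = z"
    using left_identity_inverse by metis
  moreover have "e = z" if e: "e \<in> G" "add e e = e" for e
  proof -
    obtain b where b: "b \<in> G" "add b e = z"
      using z(3)[OF e(1)] by blast
    \<comment> \<open>Rebracketing \<open>add z (add e z)\<close> shows that \<open>gyr z e\<close>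
      fixes \<open>z\<close>. The loop property carries this over to \<open>gyr b e\<close>, which
      makes \<open>z\<close> a right identity for \<open>e\<close>.\<close>
    have "add e z = add e (gyr z e z)"
      using gyroassociative[OF z(1) e(1) z(1)] z(1,2) e(1) closed by simp
    then have "gyr z e z = z"
      using add_left_cancel e(1) z(1) gyr_closed by metis
    then have "gyr b e z = z"
      using left_loop[OF b(1) e(1) z(1)] b(2) by simp
    then have "add b (add e z) = add b e"
      using add_left_inverse[OF e(1) b(1) z(1)] b(2) z(2) by simp
    then have "add e z = add e e"
      using add_left_cancel b(1) closed e z(1) by metis
    then show "e = z"
      using add_left_cancel e(1) z(1) by metis
  qed
  ultimately show thesis
    using that by blast
qed

text \<open>The ambient gyrator serves as the gyrator of \<open>H\<close>. Injectivity and
  additivity of gyrations are inherited, so only their images of \<open>H\<close> have to be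
  checked.\<close>

lemma subgyrogroupI:
  assumes H: "H \<subseteq> G" and z: "z \<in> H" "\<And>x. x \<in> H \<Longrightarrow> add z x = x"
    and add_H: "\<And>a b. \<lbrakk>a \<in> H; b \<in> H\<rbrakk> \<Longrightarrow> add a b \<in> H"
    and inv_H: "\<And>a. a \<in> H \<Longrightarrow> \<exists>b\<in>H. add b a = z"
    and gyr_H: "\<And>a b. \<lbrakk>a \<in> H; b \<in> H\<rbrakk> \<Longrightarrow> gyr a b ` H = H"
  shows "subgyrogroup H G add gyr"
proof -
  have aut: "gyro_aut H add (gyr a b)" if "a \<in> H" "b \<in> H" for a b
  proof -
    have ab: "a \<in> G" "b \<in> G"
      using that H by auto
    have "inj_on (gyr a b) H"
      using gyr_bij[OF ab] H unfolding bij_betw_def by (blast intro: inj_on_subset)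
    then show ?thesis
      using gyr_H[OF that] gyr_add[OF ab] H by (auto simp: gyro_aut_def bij_betw_def)
  qed
  have "gyrogroup H add gyr"
  proof
    show "\<exists>z\<in>H. (\<forall>x\<in>H. add z x = x) \<and> (\<forall>a\<in>H. \<exists>b\<in>H. add b a = z)"
      using z inv_H by blast
  qed (use H add_H aut in \<open>auto intro: gyroassociative left_loop\<close>)
  then show ?thesis
    using H z(1) aut unfolding subgyrogroup_def by blast
qed

end

section \<open>Signs and positive representatives in the double\<close>

locale double = gyrogroup Hp add gyr
  for Hp :: "'a set" and add gyr +
  fixes Hm :: "'a set" and \<phi> :: "'a \<Rightarrow> 'a"
  assumes disjoint: "Hp \<inter> Hm = {}" and bij: "bij_betw \<phi> Hp Hm"
begin

abbreviation "p \<equiv> pos Hp \<phi>"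
abbreviation "G \<equiv> Hp \<union> Hm"
abbreviation dadd (infixl "\<otimes>" 70) where "dadd \<equiv> double_add Hp \<phi> add"
abbreviation "dgyr \<equiv> double_gyr Hp \<phi> gyr"

lemma phi: "x \<in> Hp \<Longrightarrow> \<phi> x \<in> Hm" "x \<in> Hp \<Longrightarrow> \<phi> x \<notin> Hp"
  using bij disjoint by (auto simp: bij_betw_def)

lemma pos_pos: "x \<in> Hp \<Longrightarrow> p x = x"
  by (simp add: pos_def)

lemma pos_phi: "x \<in> Hp \<Longrightarrow> p (\<phi> x) = x"
  using phi bij by (simp add: pos_def bij_betw_def)

lemma phi_pos: "x \<in> Hm \<Longrightarrow> \<phi> (p x) = x"
  using bij disjoint by (auto simp: pos_def bij_betw_def f_inv_into_f)

lemma pos_closed: "x \<in> G \<Longrightarrow> p x \<in> Hp"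
  using bij by (auto simp: pos_def bij_betw_def inv_into_into)

lemma
  assumes "a \<in> G" "b \<in> G"
  shows dadd_in_Hp_iff: "a \<otimes> b \<in> Hp \<longleftrightarrow> (a \<in> Hp \<longleftrightarrow> b \<in> Hp)"
    and pos_dadd: "p (a \<otimes> b) = add (p a) (p b)"
  using closed[OF pos_closed[OF assms(1)] pos_closed[OF assms(2)]]
  by (auto simp: double_add_def phi pos_pos pos_phi)

lemma
  assumes "a \<in> G" "b \<in> G" "c \<in> G"
  shows dgyr_in_Hp_iff: "dgyr a b c \<in> Hp \<longleftrightarrow> c \<in> Hp"
    and pos_dgyr: "p (dgyr a b c) = gyr (p a) (p b) (p c)"
  using gyr_closed[OF pos_closed[OF assms(1)] pos_closed[OF assms(2)] pos_closed[OF assms(3)]]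
  by (auto simp: double_gyr_def phi pos_pos pos_phi)

section \<open>Positive part, sign-free image and negative part of a subgyrogroup \<open>B\<close>
  of the double\<close>

context
  fixes B
  assumes B: "subgyrogroup B G dadd dgyr"
begin

lemma sub_G: "x \<in> B \<Longrightarrow> x \<in> G"
  using B by (auto simp: subgyrogroup_def)

lemma sub_dadd: "a \<in> B \<Longrightarrow> b \<in> B \<Longrightarrow> a \<otimes> b \<in> B"
  using B gyrogroup.closed unfolding subgyrogroup_def by metis

lemma sub_dgyr_image: "a \<in> B \<Longrightarrow> b \<in> B \<Longrightarrow> dgyr a b ` B = B"
  using B by (simp add: subgyrogroup_def gyro_aut_def bij_betw_def)

text \<open>The general result is applied to \<open>B\<close> with its own unnamed gyrator, which
  does not occur in the conclusion.\<close>

lemma sub_bij_betw_dadd: "a \<in> B \<Longrightarrow> bij_betw (dadd a) B B"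
  using B gyrogroup.bij_betw_add_left unfolding subgyrogroup_def by metis

text \<open>The identity of \<open>B\<close> is a square, hence positive, and it is idempotent,
  hence equal to the identity of \<open>Hp\<close>.\<close>

lemma sub_identityE:
  obtains z where "z \<in> B" "z \<in> Hp" "\<And>x. x \<in> Hp \<Longrightarrow> add z x = x"
    "\<And>a. a \<in> B \<Longrightarrow> \<exists>b\<in>B. b \<otimes> a = z"
proof -
  obtain z where z: "z \<in> Hp" "\<And>x. x \<in> Hp \<Longrightarrow> add z x = x"
    and idem: "\<And>e. \<lbrakk>e \<in> Hp; add e e = e\<rbrakk> \<Longrightarrow> e = z"
    by (rule identityE) blast
  obtain e where e: "e \<in> B" "e \<otimes> e = e" "\<And>a. a \<in> B \<Longrightarrow> \<exists>b\<in>B. b \<otimes> a = e"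
    using B gyrogroup.left_identity_inverse[of B dadd] unfolding subgyrogroup_def by metis
  have "e \<in> Hp"
    using dadd_in_Hp_iff e(1,2) sub_G by metis
  moreover have "add e e = e"
    using pos_dadd[of e e] e(1,2) sub_G pos_pos \<open>e \<in> Hp\<close> by metis
  ultimately have "e = z"
    by (rule idem)
  then show thesis
    using that z e by blast
qed

lemma subgyrogroup_positive_part: "subgyrogroup (B \<inter> Hp) Hp add gyr"
proof -
  obtain z where z: "z \<in> B" "z \<in> Hp" "\<And>x. x \<in> Hp \<Longrightarrow> add z x = x"
    and inv: "\<And>a. a \<in> B \<Longrightarrow> \<exists>b\<in>B. b \<otimes> a = z"
    by (rule sub_identityE) blast
  show ?thesis
  proof (rule subgyrogroupI)
    show "add a b \<in> B \<inter> Hp" if "a \<in> B \<inter> Hp" "b \<in> B \<inter> Hp" for a b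
      using that sub_dadd[of a b] closed by (auto simp: double_add_def pos_pos)
    show "\<exists>b\<in>B \<inter> Hp. add b a = z" if a: "a \<in> B \<inter> Hp" for a
    proof -
      obtain b where b: "b \<in> B" "b \<otimes> a = z"
        using inv a by blast
      \<comment> \<open>The product \<open>z\<close> is positive, so both factors have the same
        sign.\<close>
      then have "b \<in> Hp"
        using dadd_in_Hp_iff[of b a] sub_G a z(2) by blast
      then show ?thesis
        using a b by (auto simp: double_add_def pos_pos)
    qed
    show "gyr a b ` (B \<inter> Hp) = B \<inter> Hp" if ab: "a \<in> B \<inter> Hp" "b \<in> B \<inter> Hp" for a b
    proof -
      have "gyr a b ` (B \<inter> Hp) = dgyr a b ` (B \<inter> Hp)"
        using ab by (intro image_cong) (auto simp: double_gyr_def pos_pos)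
      \<comment> \<open>Gyrations of the double preserve signs, so taking images commutes with
        intersecting with \<open>Hp\<close>.\<close>
      also have "\<dots> = dgyr a b ` B \<inter> Hp"
        using dgyr_in_Hp_iff[of a b] ab sub_G by blast
      finally show ?thesis
        using sub_dgyr_image ab by simp
    qed
  qed (use z in auto)
qed

lemma subgyrogroup_pos_image: "subgyrogroup (p ` B) Hp add gyr"
proof -
  obtain z where z: "z \<in> B" "z \<in> Hp" "\<And>x. x \<in> Hp \<Longrightarrow> add z x = x"
    and inv: "\<And>a. a \<in> B \<Longrightarrow> \<exists>b\<in>B. b \<otimes> a = z"
    by (rule sub_identityE) blast
  show ?thesis
  proof (rule subgyrogroupI)
    show "p ` B \<subseteq> Hp"
      using pos_closed sub_G by blast
    then show "add z x = x" if "x \<in> p ` B" for x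
      using that z(3) by blast
    show "z \<in> p ` B"
      using imageI[OF z(1), of p] pos_pos[OF z(2)] by simp
    show "add a b \<in> p ` B" if "a \<in> p ` B" "b \<in> p ` B" for a b
    proof -
      obtain a' b' where "a' \<in> B" "a = p a'" "b' \<in> B" "b = p b'"
        using \<open>a \<in> p ` B\<close> \<open>b \<in> p ` B\<close> by blast
      then show ?thesis
        using sub_dadd pos_dadd[of a' b'] sub_G by (intro image_eqI[of _ _ "a' \<otimes> b'"]) simp_all
    qed
    show "\<exists>b\<in>p ` B. add b a = z" if a: "a \<in> p ` B" for a
    proof -
      obtain a' where a': "a' \<in> B" "a = p a'"
        using a by blast
      obtain b where b: "b \<in> B" "b \<otimes> a' = z"
        using inv a'(1) by blast
      have "add (p b) a = z"
        using pos_dadd[of b a'] a' b sub_G pos_pos z(2) by metis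
      then show ?thesis
        using b(1) by blast
    qed
    show "gyr a b ` p ` B = p ` B" if ab: "a \<in> p ` B" "b \<in> p ` B" for a b
    proof -
      obtain a' b' where ab': "a' \<in> B" "a = p a'" "b' \<in> B" "b = p b'"
        using ab by blast
      \<comment> \<open>\<open>p\<close> intertwines the two gyrations, and
        \<open>dgyr a' b'\<close> maps \<open>B\<close> onto itself.\<close>
      have "gyr a b ` p ` B = p ` dgyr a' b' ` B"
        unfolding image_image ab'(2,4)
        using pos_dgyr ab' sub_G by (intro image_cong refl) metis
      then show ?thesis
        using sub_dgyr_image ab' by simp
    qed
  qed
qed

text \<open>Identifies the sign-free image of \<open>B\<close> with the union of A+ and L+, where L+
  consists of the \<open>x\<close> in \<open>Hp\<close> with \<open>\<phi> x\<close> in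
  \<open>B\<close>.\<close>

lemma pos_image: "p ` B = (B \<inter> Hp) \<union> {x \<in> Hp. \<phi> x \<in> B}"
proof (intro equalityI subsetI)
  fix x assume "x \<in> p ` B"
  then obtain b where b: "b \<in> B" "x = p b"
    by blast
  show "x \<in> (B \<inter> Hp) \<union> {x \<in> Hp. \<phi> x \<in> B}"
  proof (cases "b \<in> Hp")
    case True
    then show ?thesis using b pos_pos by simp
  next
    case False
    then show ?thesis using b sub_G[of b] phi_pos[of b] pos_closed[of b] by auto
  qed
next
  fix x assume "x \<in> (B \<inter> Hp) \<union> {x \<in> Hp. \<phi> x \<in> B}"
  then show "x \<in> p ` B"
    using pos_pos[of x] pos_phi[of x] unfolding image_iff by force
qed

lemma negative_part_disjoint_or_eq:
  "B \<inter> Hp \<inter> {x \<in> Hp. \<phi> x \<in> B} = {} \<or> {x \<in> Hp. \<phi> x \<in> B} = B \<inter> Hp"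
proof (rule disjCI)
  obtain z where z: "z \<in> B" "z \<in> Hp" "\<And>x. x \<in> Hp \<Longrightarrow> add z x = x"
    and inv: "\<And>a. a \<in> B \<Longrightarrow> \<exists>b\<in>B. b \<otimes> a = z"
    by (rule sub_identityE) blast
  assume "{x \<in> Hp. \<phi> x \<in> B} \<noteq> B \<inter> Hp"
  moreover have "{x \<in> Hp. \<phi> x \<in> B} = B \<inter> Hp"
    if x: "x \<in> B" "x \<in> Hp" "\<phi> x \<in> B" for x
  proof -
    obtain b where b: "b \<in> B" "b \<otimes> x = z"
      using inv x(1) by blast
    then have "b \<in> Hp"
      using dadd_in_Hp_iff[of b x] sub_G x z(2) by blast
    \<comment> \<open>The left inverse of x+ carries x- to 0-, which therefore lies in
      \<open>B\<close>.\<close>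
    then have "b \<otimes> \<phi> x = \<phi> z"
      using b x(2) phi by (auto simp: double_add_def pos_pos pos_phi)
    then have phi_z: "\<phi> z \<in> B"
      using sub_dadd b(1) x(3) by metis
    have "\<phi> z \<otimes> y = \<phi> y" "\<phi> z \<otimes> \<phi> y = y" if "y \<in> Hp" for y
      using that z phi by (auto simp: double_add_def pos_pos pos_phi)
    then show ?thesis
      using sub_dadd[OF phi_z] by fastforce
  qed
  ultimately show "B \<inter> Hp \<inter> {x \<in> Hp. \<phi> x \<in> B} = {}"
    by blast
qed

lemma positive_part_eqpoll_negative_part:
  assumes "\<not> B \<subseteq> Hp"
  shows "B \<inter> Hp \<approx> B \<inter> Hm"
proof -
  obtain l where l: "l \<in> B" "l \<notin> Hp"
    using assms by blast
  have im: "l \<otimes> a \<in> Hp \<longleftrightarrow> a \<notin> Hp" if "a \<in> B" for a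
    using dadd_in_Hp_iff[of l a] sub_G l that by blast
  have "inj_on (dadd l) (B \<inter> Hp)"
    using sub_bij_betw_dadd[OF l(1)] unfolding bij_betw_def by (blast intro: inj_on_subset)
  \<comment> \<open>Because translation by \<open>l\<close> reverses signs, the non-positive values
    come exactly from the positive arguments.\<close>
  moreover have "dadd l ` (B \<inter> Hp) = dadd l ` B - Hp"
    using im by blast
  then have "dadd l ` (B \<inter> Hp) = B \<inter> Hm"
    using sub_bij_betw_dadd[OF l(1)] sub_G disjoint unfolding bij_betw_def by blast
  ultimately show ?thesis
    unfolding eqpoll_def bij_betw_def by blast
qed

end

end

theorem theorem2p11:
  fixes Hp Hm B :: "'a set"
    and add :: "'a \<Rightarrow> 'a \<Rightarrow> 'a"
    and gyr :: "'a \<Rightarrow> 'a \<Rightarrow> 'a \<Rightarrow> 'a"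
    and \<phi> :: "'a \<Rightarrow> 'a"
  assumes "gyrogroup Hp add gyr"
    and "Hp \<inter> Hm = {}"
    and "bij_betw \<phi> Hp Hm"
    and "subgyrogroup B (Hp \<union> Hm) (double_add Hp \<phi> add) (double_gyr Hp \<phi> gyr)"
    and "\<not> B \<subseteq> Hp"
  shows "\<exists>Ap Lm. subgyrogroup Ap Hp add gyr \<and> Lm \<subseteq> Hm \<and> B = Ap \<union> Lm \<and>
           (let Lp = {x \<in> Hp. \<phi> x \<in> Lm} in
              (Ap \<inter> Lp = {} \<or> Lp = Ap) \<and>
              subgyrogroup (Ap \<union> Lp) Hp add gyr \<and>
              Ap \<approx> Lm)"
proof -
  interpret double Hp add gyr Hm \<phi>
    using assms(1-3) by (simp add: double_def double_axioms_def)
  note B = assms(4)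
  \<comment> \<open>The witnesses are \<open>B \<inter> Hp\<close> and \<open>B \<inter> Hm\<close>.
    As \<open>Hp\<close> and \<open>Hm\<close> are disjoint, no other choice is possible, so the
    existential form of the statement loses nothing.\<close>
  have Lp: "{x \<in> Hp. \<phi> x \<in> B \<inter> Hm} = {x \<in> Hp. \<phi> x \<in> B}"
    using phi by blast
  have "B = (B \<inter> Hp) \<union> (B \<inter> Hm)"
    using sub_G[OF B] by blast
  moreover have "let Lp = {x \<in> Hp. \<phi> x \<in> B \<inter> Hm} in
      ((B \<inter> Hp) \<inter> Lp = {} \<or> Lp = B \<inter> Hp) \<and>
      subgyrogroup ((B \<inter> Hp) \<union> Lp) Hp add gyr \<and> B \<inter> Hp \<approx> B \<inter> Hm"
    unfolding Let_def Lp pos_image[OF B, symmetric]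
    using negative_part_disjoint_or_eq[OF B] subgyrogroup_pos_image[OF B]
      positive_part_eqpoll_negative_part[OF B assms(5)] by (intro conjI)
  ultimately show ?thesis
    using subgyrogroup_positive_part[OF B] by (intro exI conjI) (assumption | rule Int_lower2)+
qed

end
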